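(* Let $a,q\in\mathbb{Z}$ with $q>0$ and $\gcd(a,q)=1$. Then \[ S(a/q)=\#\Big\{(c,d)\in\mathbb{Z}^2\ :\ d>0,\ 0<\frac aq-\frac cd<\frac1{d^2}\Big\}. \]
   Context: $S(a/q):=\#\{(m,n)\in\mathbb{Z}^2:\ m>0,\ n>0,\ mn<q,\ am\equiv n \pmod q\}$. Note the pairs $(c,d)$ on the right-hand side are not required to be coprime. *)

theory Defs
  imports Complex_Main "HOL-Number_Theory.Cong"
begin

text \<open>The numerator and denominator are passed separately; \<open>S a q\<close> stands for \<open>S(a/q)\<close>
  when \<open>q > 0\<close> and \<open>coprime a q\<close>, in which case \<open>a\<close> and \<open>q\<close> are determined by the fraction.\<close>

definition S_pairs :: "int \<Rightarrow> int \<Rightarrow> (int \<times> int) set" where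
  "S_pairs a q = {(m, n). m > 0 \<and> n > 0 \<and> m * n < q \<and> [a * m = n] (mod q)}"

definition S :: "int \<Rightarrow> int \<Rightarrow> nat" where
  "S a q = card (S_pairs a q)"

lemma finite_S_pairs: "finite (S_pairs a q)"
proof (rule finite_subset)
  show "S_pairs a q \<subseteq> {0..q} \<times> {0..q}"
  proof
    fix p assume "p \<in> S_pairs a q"
    then obtain m n where p: "p = (m, n)" and *: "m > 0" "n > 0" "m * n < q"
      by (auto simp: S_pairs_def)
    have "m \<le> m * n" "n \<le> m * n" using * by auto
    with * have "m \<le> q" "n \<le> q" by linarith+
    then show "p \<in> {0..q} \<times> {0..q}" using p * by simp
  qed
qed simp

definition lower_approximations :: "int \<Rightarrow> int \<Rightarrow> (int \<times> int) set" where
  "lower_approximations a q =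
     {(c, d). d > 0 \<and>
        0 < real_of_int a / real_of_int q - real_of_int c / real_of_int d \<and>
        real_of_int a / real_of_int q - real_of_int c / real_of_int d < 1 / (real_of_int d)\<^sup>2}"

end

theory Submission
  imports Defs
begin

text \<open>Write \<open>a/q - c/d = n/(qd)\<close> with \<open>n = ad - cq\<close>. The two inequalities become \<open>n > 0\<close> and
  \<open>dn < q\<close>, so \<open>(c, d) \<mapsto> (d, ad - cq)\<close> is a bijection onto the pairs counted by \<open>S(a/q)\<close>;
  the congruence \<open>ad \<equiv> n (mod q)\<close> says exactly that \<open>c\<close> can be recovered.\<close>

lemma mem_lower_approximations_iff:
  assumes "q > 0"
  shows "(c, d) \<in> lower_approximations a q \<longleftrightarrow>
           d > 0 \<and> a * d - c * q > 0 \<and> d * (a * d - c * q) < q"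
proof (cases "d > 0")
  case True
  define n where "n = a * d - c * q"
  have diff: "real_of_int a / real_of_int q - real_of_int c / real_of_int d =
      real_of_int n / (real_of_int q * real_of_int d)"
    using assms True by (simp add: n_def field_simps)
  have "0 < real_of_int n / (real_of_int q * real_of_int d) \<longleftrightarrow> n > 0"
    using assms True by (simp add: zero_less_divide_iff mult_less_0_iff)
  \<comment> \<open>Multiplying by \<open>q * d\<^sup>2\<close> > 0 cancels one factor
    \<open>d\<close> on the left.\<close>
  moreover have "real_of_int n / (real_of_int q * real_of_int d) < 1 / (real_of_int d)\<^sup>2 \<longleftrightarrow>
      real_of_int (d * n) < real_of_int q"
    using assms True by (simp add: divide_simps power2_eq_square mult_ac)
  ultimately show ?thesis
    using True unfolding lower_approximations_def mem_Collect_eq prod.case diff n_def[symmetric] of_int_less_iff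
    by blast
qed (simp add: lower_approximations_def)

lemma bij_betw_lower_approximations:
  assumes "q > 0"
  shows "bij_betw (\<lambda>(c, d). (d, a * d - c * q)) (lower_approximations a q) (S_pairs a q)"
proof (rule bij_betw_byWitness[where f' = "\<lambda>(m, n). ((a * m - n) div q, m)"])
  \<comment> \<open>The congruence makes this \<open>div\<close> exact.\<close>
  have recover: "(a * m - n) div q * q = a * m - n" if "(m, n) \<in> S_pairs a q" for m n
    using that by (simp add: S_pairs_def cong_iff_dvd_diff)
  show "\<forall>p\<in>lower_approximations a q.
      (\<lambda>(m, n). ((a * m - n) div q, m)) ((\<lambda>(c, d). (d, a * d - c * q)) p) = p"
    using assms by auto
  show "\<forall>p\<in>S_pairs a q.
      (\<lambda>(c, d). (d, a * d - c * q)) ((\<lambda>(m, n). ((a * m - n) div q, m)) p) = p"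
    using recover by auto
  show "(\<lambda>(c, d). (d, a * d - c * q)) ` lower_approximations a q \<subseteq> S_pairs a q"
    using assms by (auto simp: mem_lower_approximations_iff S_pairs_def cong_iff_dvd_diff)
  show "(\<lambda>(m, n). ((a * m - n) div q, m)) ` S_pairs a q \<subseteq> lower_approximations a q"
    \<comment> \<open>Membership in \<open>S_pairs\<close> stays folded while \<open>recover\<close>
      reduces \<open>a * m - c * q\<close> to \<open>n\<close>; unfolding it then gives the
      bounds.\<close>
    using assms recover by (auto simp: mem_lower_approximations_iff) (auto simp: S_pairs_def)
qed

text \<open>Since \<open>card\<close> is 0 on infinite sets, finiteness is asserted too, making the
  equality a genuine count.\<close>

theorem theorem3:
  fixes a q :: int
  assumes "q > 0" and "gcd a q = 1"
  shows "finite (lower_approximations a q) \<and> S a q = card (lower_approximations a q)"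
  using bij_betw_lower_approximations[OF assms(1), of a] finite_S_pairs[of a q]
  by (simp add: S_def bij_betw_finite bij_betw_same_card)

end
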